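(* Let $(x_1,x_2,x_3)\in\mathbb{R}^3$ with $(x_1,x_2,x_3)\neq(0,0,0)$. Then: (i) $(x_1+x_2+x_3)^4+9(x_1^2x_2^2+x_1^2x_3^2+x_2^2x_3^2)>8(x_1x_3^3+x_1^3x_2+x_2^3x_3)$; (ii) $(x_1+x_2+x_3)^4+10(x_1^2x_2^2+x_1^2x_3^2+x_2^2x_3^2)>8(x_1x_3^3+x_1^3x_2+x_2^3x_3)+24x_1x_2x_3^2$; (iii) $(x_1+x_2-x_3)^4+10(x_1^2x_2^2+x_1^2x_3^2+x_2^2x_3^2)>8(x_1^3x_2-x_1^3x_3-x_2x_3^3)+24x_1x_2x_3^2$; (iv) $(x_1+x_2-x_3)^4+9(x_1^2x_2^2+x_1^2x_3^2+x_2^2x_3^2)>8(x_1^3x_2-x_1^3x_3-x_2x_3^3)$. Furthermore, each of these strict inequalities still holds if, in the expression multiplied by $8$ on the right-hand side, any one or more of the following exchanges are made: $x_1^3x_2$ is exchanged for $x_1x_2^3$; $x_1^3x_3$ and $x_1x_3^3$ are exchanged (whichever of the two occurs is replaced by the other); $x_2x_3^3$ and $x_2^3x_3$ are exchanged (whichever of the two occurs is replaced by the other). *)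

theory Defs
  imports Complex_Main
begin

end

(*
Every inequality is of the form F > 8 (m12 + m13 + m23) up to the sign of x3. Writing
2 x^3 y = (x^3 y + x y^3) + (x^3 y - x y^3), the symmetric halves are absorbed by the fourth power,
and what remains is a symmetric quartic against 4 times a signed sum of the skew terms
x_i^3 x_j - x_i x_j^3. Up to permutation the three signs form either a transitive or a cyclic
tournament. The term 24 x1 x2 x3^2 turns the symmetric quartic with +12 xyz(x + y + z) into the one
with -12 xyz(x + y + z), after x3 is replaced by -x3 in (ii). For each of the four resulting quartics
there is an explicit sum of squares.
*)
theory Submission
  imports Defs
begin

text \<open>This is (x + y + z)^4 + 9 ((xy)^2 + (xz)^2 + (yz)^2) with 4 (x^3 y + x y^3), and the
  same for the other two pairs, removed.\<close>

definition quartic_plus :: "real \<Rightarrow> real \<Rightarrow> real \<Rightarrow> real" where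
  "quartic_plus x y z = x^4 + y^4 + z^4 + 15 * ((x*y)^2 + (x*z)^2 + (y*z)^2)
     + 12 * (x*y*z) * (x + y + z)"

definition quartic_minus :: "real \<Rightarrow> real \<Rightarrow> real \<Rightarrow> real" where
  "quartic_minus x y z = x^4 + y^4 + z^4 + 16 * ((x*y)^2 + (x*z)^2 + (y*z)^2)
     - 12 * (x*y*z) * (x + y + z)"

definition skew :: "real \<Rightarrow> real \<Rightarrow> real" where
  "skew x y = x^3 * y - x * y^3"

lemmas quartic_defs = quartic_plus_def quartic_minus_def skew_def

lemma skew_commute: "skew y x = - skew x y"
  by (simp add: skew_def)

lemma skew_minus_right: "skew x (- y) = - skew x y"
  by (simp add: skew_def)

lemma sum_fourth_powers_pos:
  fixes x y z :: real
  assumes "(x, y, z) \<noteq> (0, 0, 0)"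
  shows "0 < x^4 + y^4 + z^4"
proof -
  have "0 \<le> x^4" "0 \<le> y^4" "0 \<le> z^4"
    by simp_all
  moreover have "0 < x^4 \<or> 0 < y^4 \<or> 0 < z^4"
    using assms by auto
  ultimately show ?thesis
    by linarith
qed

text \<open>The first three squares reproduce the fourth powers and every term of type x^3 y. What
  remains is a positive definite quadratic form in xy, xz, yz; the last terms of those squares
  adjust it, since x^2 * yz = xy * xz.\<close>

lemma quartic_plus_gt_transitive:
  assumes "(x, y, z) \<noteq> (0, 0, 0)"
  shows "4 * (skew x y + skew x z + skew y z) < quartic_plus x y z"
\<comment> \<open>The strict surplus is a form in the products, so the coordinate axes are separate:
  there the skew terms vanish and only fourth powers remain.\<close>
proof (cases "x*y = 0 \<and> x*z = 0 \<and> y*z = 0")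
  case True
  then show ?thesis
    using sum_fourth_powers_pos[OF assms] by (auto simp: quartic_defs)
next
  case False
  have "quartic_plus x y z - 4 * (skew x y + skew x z + skew y z)
      = (x^2 - 2*x*y - 2*x*z - y*z)^2 + (y^2 + 2*x*y - 2*y*z + x*z)^2
        + (z^2 + 2*x*z + 2*y*z + x*y)^2
        + 5 * (x*y + y*z)^2 + (x*y - 2*x*z)^2 / 2 + (y*z + 2*x*z)^2 / 2
        + (x*y)^2 / 2 + 2 * (x*z)^2 + (y*z)^2 / 2"
    unfolding quartic_defs by (simp add: field_simps) algebra
  moreover have "0 < (x*y)^2 / 2 + 2 * (x*z)^2 + (y*z)^2 / 2"
    using False by (auto simp: add_nonneg_pos add_pos_nonneg)
  ultimately show ?thesis
    by (smt (verit) zero_le_power2 divide_nonneg_pos)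
qed

text \<open>The first three squares come from the sum-of-squares form of Vasc's inequality for cyclic
  quartics; the surplus is \<open>2 |u|\<^sup>2 + 26/3 (u1 + u2 + u3)\<^sup>2\<close> for \<open>u = (xy, yz, zx)\<close>.\<close>

lemma quartic_plus_gt_cyclic:
  assumes "(x, y, z) \<noteq> (0, 0, 0)"
  shows "4 * (skew x y + skew y z + skew z x) < quartic_plus x y z"
proof (cases "x*y = 0 \<and> x*z = 0 \<and> y*z = 0")
  case True
  then show ?thesis
    using sum_fourth_powers_pos[OF assms] by (auto simp: quartic_defs)
next
  case False
  have "6 * (quartic_plus x y z - 4 * (skew x y + skew y z + skew z x))
      = (2*x^2 - y^2 - z^2 - 4*x*y + 4*z*x)^2 + (2*y^2 - z^2 - x^2 - 4*y*z + 4*x*y)^2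
        + (2*z^2 - x^2 - y^2 - 4*z*x + 4*y*z)^2
        + 52 * (x*y + y*z + z*x)^2 + 12 * ((x*y)^2 + (x*z)^2 + (y*z)^2)"
    unfolding quartic_defs by algebra
  moreover have "0 < (x*y)^2 + (x*z)^2 + (y*z)^2"
    using False by (auto simp: add_nonneg_pos add_pos_nonneg)
  ultimately show ?thesis
    by (smt (verit) zero_le_power2)
qed

text \<open>Here y is the middle vertex of the tournament. After doubling, one copy of y^4 goes into
  the two squares containing y^2/2, which yield the terms in x y^3 and y^3 z; the other copy is the
  surplus. Hence the split on y = 0, where a binary quartic in x and z is left.\<close>

lemma quartic_minus_gt_transitive:
  assumes "(x, y, z) \<noteq> (0, 0, 0)"
  shows "4 * (skew x y + skew x z + skew y z) < quartic_minus x y z"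
proof (cases "y = 0")
  case True
  have "quartic_minus x y z - 4 * (skew x y + skew x z + skew y z)
      = (x^2 - 2*x*z - z^2)^2 + 14 * (x*z)^2"
    using True unfolding quartic_defs by algebra
  \<comment> \<open>If x or z is zero, the first square is the fourth power of the other, nonzero
    coordinate.\<close>
  moreover have "0 < (x^2 - 2*x*z - z^2)^2 + 14 * (x*z)^2"
    using True assms by (cases "x = 0"; cases "z = 0") (auto simp: add_nonneg_pos)
  ultimately show ?thesis
    by linarith
next
  case False
  have "2 * (quartic_minus x y z - 4 * (skew x y + skew x z + skew y z))
      = 2 * (x^2 - y^2/2 - 2*x*z - 2*x*y + 2*y*z)^2
        + 2 * (z^2 - y^2/2 + 2*x*z - 2*x*y + 2*y*z)^2
        + 4 * (2*x*z - 2*x*y - y*z)^2 + 2 * (x*y - 2*y*z)^2 + 6 * (y*z)^2 + y^4"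
    unfolding quartic_defs by (simp add: field_simps) algebra
  moreover have "0 < y^4"
    using False by simp
  ultimately show ?thesis
    by (smt (verit) zero_le_power2)
qed

text \<open>The three leading squares are cyclic shifts of one another and carry all terms of type
  x^3 y; the rest is again positive definite in the products.\<close>

lemma quartic_minus_gt_cyclic:
  assumes "(x, y, z) \<noteq> (0, 0, 0)"
  shows "4 * (skew x y + skew y z + skew z x) < quartic_minus x y z"
proof (cases "x*y = 0 \<and> x*z = 0 \<and> y*z = 0")
  case True
  then show ?thesis
    using sum_fourth_powers_pos[OF assms] by (auto simp: quartic_defs)
next
  case False
  have "quartic_minus x y z - 4 * (skew x y + skew y z + skew z x)
      = (x^2 - 2*x*y + 2*z*x)^2 + (y^2 - 2*y*z + 2*x*y)^2 + (z^2 - 2*z*x + 2*y*z)^2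
        + 2 * (x*y - y*z)^2 + 2 * (y*z - z*x)^2 + 2 * (z*x - x*y)^2
        + 4 * ((x*y)^2 + (x*z)^2 + (y*z)^2)"
    unfolding quartic_defs by algebra
  moreover have "0 < (x*y)^2 + (x*z)^2 + (y*z)^2"
    using False by (auto simp: add_nonneg_pos add_pos_nonneg)
  ultimately show ?thesis
    by (smt (verit) zero_le_power2)
qed

text \<open>The eight sign patterns are the orientations of a triangle: six transitive ones, one per
  ordering of the variables, and two cyclic ones. As \<open>F\<close> is symmetric, permuting the
  arguments of \<open>trans\<close> and \<open>cyc\<close> reaches all of them.\<close>

lemma signed_skew_bound:
  fixes F :: "real \<Rightarrow> real \<Rightarrow> real \<Rightarrow> real"
  assumes sym: "\<And>x y z. F y x z = F x y z" "\<And>x y z. F x z y = F x y z"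
    and trans: "\<And>x y z. (x, y, z) \<noteq> (0, 0, 0) \<Longrightarrow>
      4 * (skew x y + skew x z + skew y z) < F x y z"
    and cyc: "\<And>x y z. (x, y, z) \<noteq> (0, 0, 0) \<Longrightarrow>
      4 * (skew x y + skew y z + skew z x) < F x y z"
    and nz: "(x, y, z) \<noteq> (0, 0, 0)"
    and signs: "a \<in> {1, -1}" "b \<in> {1, -1}" "c \<in> {1, -1}"
  shows "4 * (a * skew x y + b * skew x z + c * skew y z) < F x y z"
proof -
  have perms: "F x z y = F x y z" "F y x z = F x y z" "F y z x = F x y z"
    "F z x y = F x y z" "F z y x = F x y z"
    by (metis sym)+
  note skews = skew_commute[of x y] skew_commute[of x z] skew_commute[of y z]
  have "4 * (skew x y + skew x z + skew y z) < F x y z"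
    "4 * (skew x y + skew x z - skew y z) < F x y z"
    "4 * (- skew x y + skew x z + skew y z) < F x y z"
    "4 * (- skew x y - skew x z + skew y z) < F x y z"
    "4 * (skew x y - skew x z - skew y z) < F x y z"
    "4 * (- skew x y - skew x z - skew y z) < F x y z"
    "4 * (skew x y - skew x z + skew y z) < F x y z"
    "4 * (- skew x y + skew x z - skew y z) < F x y z"
    using trans[of x y z] trans[of x z y] trans[of y x z] trans[of y z x] trans[of z x y]
      trans[of z y x] cyc[of x y z] cyc[of y x z] nz
    unfolding perms skews by auto
  then show ?thesis
    using signs by auto
qed

lemma quartic_plus_gt:
  assumes "(x, y, z) \<noteq> (0, 0, 0)" "a \<in> {1, -1}" "b \<in> {1, -1}" "c \<in> {1, -1}"
  shows "4 * (a * skew x y + b * skew x z + c * skew y z) < quartic_plus x y z"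
  by (rule signed_skew_bound[OF _ _ quartic_plus_gt_transitive quartic_plus_gt_cyclic assms])
    (simp_all add: quartic_plus_def algebra_simps)

lemma quartic_minus_gt:
  assumes "(x, y, z) \<noteq> (0, 0, 0)" "a \<in> {1, -1}" "b \<in> {1, -1}" "c \<in> {1, -1}"
  shows "4 * (a * skew x y + b * skew x z + c * skew y z) < quartic_minus x y z"
  by (rule signed_skew_bound[OF _ _ quartic_minus_gt_transitive quartic_minus_gt_cyclic assms])
    (simp_all add: quartic_minus_def algebra_simps)

text \<open>This turns each allowed exchange of monomials into a sign of a skew term.\<close>

lemma monomial_choice:
  fixes x y m :: real
  assumes "m \<in> {x^3 * y, x * y^3}"
  obtains e where "e \<in> {1, -1}" "2 * m = x^3 * y + x * y^3 + e * skew x y"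
proof -
  have "2 * m = x^3 * y + x * y^3 + 1 * skew x y \<or> 2 * m = x^3 * y + x * y^3 + (-1) * skew x y"
    using assms by (auto simp: skew_def)
  then show thesis
    using that by blast
qed

theorem corollary3p3:
  fixes x1 x2 x3 :: real
  assumes "(x1, x2, x3) \<noteq> (0, 0, 0)"
  shows
    "((x1 + x2 + x3)^4 + 9 * (x1^2 * x2^2 + x1^2 * x3^2 + x2^2 * x3^2)
       > 8 * (x1 * x3^3 + x1^3 * x2 + x2^3 * x3))
     \<and> ((x1 + x2 + x3)^4 + 10 * (x1^2 * x2^2 + x1^2 * x3^2 + x2^2 * x3^2)
       > 8 * (x1 * x3^3 + x1^3 * x2 + x2^3 * x3) + 24 * x1 * x2 * x3^2)
     \<and> ((x1 + x2 - x3)^4 + 10 * (x1^2 * x2^2 + x1^2 * x3^2 + x2^2 * x3^2)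
       > 8 * (x1^3 * x2 - x1^3 * x3 - x2 * x3^3) + 24 * x1 * x2 * x3^2)
     \<and> ((x1 + x2 - x3)^4 + 9 * (x1^2 * x2^2 + x1^2 * x3^2 + x2^2 * x3^2)
       > 8 * (x1^3 * x2 - x1^3 * x3 - x2 * x3^3))
     \<and> (\<forall>m12 \<in> {x1^3 * x2, x1 * x2^3}. \<forall>m13 \<in> {x1^3 * x3, x1 * x3^3}. \<forall>m23 \<in> {x2^3 * x3, x2 * x3^3}.
       (x1 + x2 + x3)^4 + 9 * (x1^2 * x2^2 + x1^2 * x3^2 + x2^2 * x3^2)
         > 8 * (m13 + m12 + m23)
     \<and> (x1 + x2 + x3)^4 + 10 * (x1^2 * x2^2 + x1^2 * x3^2 + x2^2 * x3^2)
         > 8 * (m13 + m12 + m23) + 24 * x1 * x2 * x3^2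
     \<and> (x1 + x2 - x3)^4 + 10 * (x1^2 * x2^2 + x1^2 * x3^2 + x2^2 * x3^2)
         > 8 * (m12 - m13 - m23) + 24 * x1 * x2 * x3^2
     \<and> (x1 + x2 - x3)^4 + 9 * (x1^2 * x2^2 + x1^2 * x3^2 + x2^2 * x3^2)
         > 8 * (m12 - m13 - m23))"
proof -
  let ?Q = "x1^2 * x2^2 + x1^2 * x3^2 + x2^2 * x3^2"
  have nz: "(x1, x2, - x3) \<noteq> (0, 0, 0)"
    using assms by auto
  have main: "(x1 + x2 + x3)^4 + 9 * ?Q > 8 * (m13 + m12 + m23)
     \<and> (x1 + x2 + x3)^4 + 10 * ?Q > 8 * (m13 + m12 + m23) + 24 * x1 * x2 * x3^2
     \<and> (x1 + x2 - x3)^4 + 10 * ?Q > 8 * (m12 - m13 - m23) + 24 * x1 * x2 * x3^2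
     \<and> (x1 + x2 - x3)^4 + 9 * ?Q > 8 * (m12 - m13 - m23)"
    if m12: "m12 \<in> {x1^3 * x2, x1 * x2^3}" and m13: "m13 \<in> {x1^3 * x3, x1 * x3^3}"
      and m23: "m23 \<in> {x2^3 * x3, x2 * x3^3}" for m12 m13 m23
  proof -
    obtain a where a: "a \<in> {1, -1}" and a_eq: "2 * m12 = x1^3 * x2 + x1 * x2^3 + a * skew x1 x2"
      using monomial_choice[OF m12] .
    obtain b where b: "b \<in> {1, -1}" and b_eq: "2 * m13 = x1^3 * x3 + x1 * x3^3 + b * skew x1 x3"
      using monomial_choice[OF m13] .
    obtain c where c: "c \<in> {1, -1}" and c_eq: "2 * m23 = x2^3 * x3 + x2 * x3^3 + c * skew x2 x3"
      using monomial_choice[OF m23] .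
    \<comment> \<open>In (ii), x3 becomes -x3, which flips the skew terms containing it, so -b and
      -c restore the signs. In (iii) they come from -m13 and -m23. In (iv) the flip alone gives
      these minus signs.\<close>
    have bc: "- b \<in> {1, -1}" "- c \<in> {1, -1}"
      using b c by auto
    have "(x1 + x2 + x3)^4 + 9 * ?Q
        = quartic_plus x1 x2 x3
          + 4 * (x1^3*x2 + x1*x2^3 + (x1^3*x3 + x1*x3^3) + (x2^3*x3 + x2*x3^3))"
      unfolding quartic_plus_def by algebra
    moreover have "(x1 + x2 + x3)^4 + 10 * ?Q
        = quartic_minus x1 x2 (- x3) + 24 * x1 * x2 * x3^2
          + 4 * (x1^3*x2 + x1*x2^3 + (x1^3*x3 + x1*x3^3) + (x2^3*x3 + x2*x3^3))"
      unfolding quartic_minus_def by algebra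
    moreover have "(x1 + x2 - x3)^4 + 10 * ?Q
        = quartic_minus x1 x2 x3 + 24 * x1 * x2 * x3^2
          + 4 * (x1^3*x2 + x1*x2^3 - (x1^3*x3 + x1*x3^3) - (x2^3*x3 + x2*x3^3))"
      unfolding quartic_minus_def by algebra
    moreover have "(x1 + x2 - x3)^4 + 9 * ?Q
        = quartic_plus x1 x2 (- x3)
          + 4 * (x1^3*x2 + x1*x2^3 - (x1^3*x3 + x1*x3^3) - (x2^3*x3 + x2*x3^3))"
      unfolding quartic_plus_def by algebra
    ultimately show ?thesis
      using quartic_plus_gt[OF assms a b c] quartic_minus_gt[OF nz a bc]
        quartic_minus_gt[OF assms a bc] quartic_plus_gt[OF nz a b c] a_eq b_eq c_eq
      by (simp add: skew_minus_right)
  qed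
  \<comment> \<open>The original inequalities are two instances of \<open>main\<close>: one choice
    of monomials for (i) and (ii), another for (iii) and (iv).\<close>
  show ?thesis
    using main main[of "x1^3 * x2" "x1 * x3^3" "x2^3 * x3"]
      main[of "x1^3 * x2" "x1^3 * x3" "x2 * x3^3"]
    by blast
qed

end
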